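(* Let $\mathbf{K}$ be a field, let $m>n\geq 1$ be integers, and let $f_1,\ldots,f_m\in\mathbf{K}[X_1,\ldots,X_n]$ be homogeneous polynomials of degree $2$ such that $\mathbf{K}[X_1,\ldots,X_n]/(f_1,\ldots,f_m)$ is finite-dimensional over $\mathbf{K}$ and $f_1,\ldots,f_m$ is a semi-regular sequence. If the discriminant $(2m-n+1)^2-4n^2$ of the polynomial $t(k)=k^2-(2m-n+3)k+2m-n+2+n^2$ is non-negative, then its smaller root yields the upper bound $$d_{reg}\leq 1+\left\lceil\tfrac12\left(2m-n+3-\sqrt{(2m-n+1)^2-4n^2}\right)\right\rceil.$$
   Context: For a graded algebra or homogeneous ideal, a subscript $d$ denotes the degree-$d$ homogeneous component. Let $J=(f_1,\ldots,f_m)$. The degree of regularity is $d_{reg}=\min\{d\geq 0: \dim_{\mathbf{K}} J_d=\dim_{\mathbf{K}}\mathbf{K}[X_1,\ldots,X_n]_d\}$. The sequence $f_1,\ldots,f_m$ is semi-regular if for each $i=1,\ldots,m$ and each $j<d_{reg}-2$ the multiplication map $S(i-1)_j\to S(i-1)_{j+2}$, $g\mapsto gf_i$, is injective, where $S(i-1)=\mathbf{K}[X_1,\ldots,X_n]/(f_1,\ldots,f_{i-1})$. *)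

theory Defs
  imports
    Complex_Main
    "HOL-Library.Cardinality"
    "HOL-Library.Poly_Mapping"
    "HOL-Library.Quadratic_Discriminant"
begin

text \<open>Polynomials over \<^typ>\<open>'k\<close> in variables indexed by the finite type \<^typ>\<open>'n\<close>. A monomial is its
  exponent vector. As addition of exponent vectors is the monoid operation, the multiplication
  that \<^theory>\<open>HOL-Library.Poly_Mapping\<close> provides is the product of polynomials.\<close>

type_synonym ('n, 'k) mpoly = "('n \<Rightarrow>\<^sub>0 nat) \<Rightarrow>\<^sub>0 'k"

definition mono_degree :: "('n::finite \<Rightarrow>\<^sub>0 nat) \<Rightarrow> nat" where
  "mono_degree a = (\<Sum>x\<in>UNIV. Poly_Mapping.lookup a x)"

text \<open>Zero is homogeneous of every degree.\<close>

definition homogeneous_part :: "nat \<Rightarrow> ('n::finite, 'k::zero) mpoly set" where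
  "homogeneous_part d = {p. \<forall>a\<in>Poly_Mapping.keys p. mono_degree a = d}"

definition poly_scale :: "'k \<Rightarrow> ('n, 'k::field) mpoly \<Rightarrow> ('n, 'k) mpoly" where
  "poly_scale c p = Poly_Mapping.map ((*) c) p"

lemma lookup_poly_scale [simp]:
  "Poly_Mapping.lookup (poly_scale c p) a = c * Poly_Mapping.lookup p a"
  by (simp add: poly_scale_def Poly_Mapping.map.rep_eq when_def)

global_interpretation poly_vs: vector_space
  "poly_scale :: 'k \<Rightarrow> ('n, 'k::field) mpoly \<Rightarrow> ('n, 'k) mpoly"
  by unfold_locales (auto intro!: poly_mapping_eqI simp: lookup_add algebra_simps)

text \<open>The ideal generated by \<^term>\<open>G\<close> is the span of \<^term>\<open>G\<close> in the ring viewed as a module over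
  itself.\<close>

global_interpretation self_module: module "(*) :: 'a::comm_ring_1 \<Rightarrow> 'a \<Rightarrow> 'a"
  defines gen_ideal = self_module.span
  by unfold_locales (simp_all add: algebra_simps)

text \<open>The quotient by an ideal is \<^term>\<open>UNIV // residue_rel I\<close>, and the image in it of a set
  \<^term>\<open>A\<close> of ring elements is \<^term>\<open>A // residue_rel I\<close>.\<close>

definition residue_rel :: "'a::comm_ring_1 set \<Rightarrow> ('a \<times> 'a) set" where
  "residue_rel I = {(p, q). q - p \<in> I}"

text \<open>The map induced on residue classes by multiplication with \<^term>\<open>h\<close>; see
  \<open>quotient_mult_class\<close> below.\<close>

definition quotient_mult :: "'a::comm_ring_1 set \<Rightarrow> 'a \<Rightarrow> 'a set \<Rightarrow> 'a set" where
  "quotient_mult I h C = residue_rel I `` ((\<lambda>g. g * h) ` C)"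

lemma equiv_residue_rel: "equiv UNIV (residue_rel (gen_ideal G))"
proof (rule equivI)
  show "refl (residue_rel (gen_ideal G))"
    by (auto simp: refl_on_def residue_rel_def self_module.span_zero)
  show "sym (residue_rel (gen_ideal G))"
    unfolding sym_def residue_rel_def using self_module.span_neg by fastforce
  show "trans (residue_rel (gen_ideal G))"
    unfolding trans_def residue_rel_def using self_module.span_add by fastforce
qed auto

lemma quotient_mult_class:
  "quotient_mult (gen_ideal G) h (residue_rel (gen_ideal G) `` {g}) =
    residue_rel (gen_ideal G) `` {g * h}"
proof -
  let ?r = "residue_rel (gen_ideal G)"
  have *: "(g * h, g' * h) \<in> ?r" if "(g, g') \<in> ?r" for g'
    using that self_module.span_scale[of "g' - g" G h]
    by (simp add: residue_rel_def algebra_simps)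
  have tr: "trans ?r" and rf: "(g, g) \<in> ?r"
    using equiv_residue_rel[of G] by (auto simp: equiv_def refl_on_def)
  show ?thesis
    unfolding quotient_mult_def using * tr rf by (auto dest: transD)
qed

text \<open>Finite-dimensionality of the quotient: some finite set of residue classes spans it. A linear
  combination of the classes of the elements of \<^term>\<open>B\<close> is the class of a linear combination
  of these elements.\<close>

definition finite_dim_quotient :: "('n, 'k::field) mpoly set \<Rightarrow> bool" where
  "finite_dim_quotient I \<longleftrightarrow>
    (\<exists>B. finite B \<and> (\<forall>C \<in> UNIV // residue_rel I. \<exists>q \<in> poly_vs.span B. C = residue_rel I `` {q}))"

text \<open>This is meaningful only if some degree qualifies, which is the case when the quotient by the
  homogeneous ideal \<^term>\<open>J\<close> is finite-dimensional.\<close>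

definition degree_of_regularity :: "('n::finite, 'k::field) mpoly set \<Rightarrow> nat" where
  "degree_of_regularity J =
    (LEAST d. poly_vs.dim (J \<inter> homogeneous_part d) =
              poly_vs.dim (homogeneous_part d :: ('n, 'k) mpoly set))"

text \<open>\<open>j + 2 < d\<^sub>r\<^sub>e\<^sub>g\<close> renders \<open>j < d\<^sub>r\<^sub>e\<^sub>g - 2\<close> without truncated subtraction. For \<open>f\<^sub>i\<close> homogeneous of
  degree 2 the multiplication map sends the degree \<open>j\<close> part of the quotient into its degree
  \<open>j + 2\<close> part.\<close>

definition semi_regular :: "nat \<Rightarrow> (nat \<Rightarrow> ('n::finite, 'k::field) mpoly) \<Rightarrow> bool" where
  "semi_regular m f \<longleftrightarrow>
    (\<forall>i \<in> {1..m}. \<forall>j. j + 2 < degree_of_regularity (gen_ideal (f ` {1..m})) \<longrightarrow>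
      inj_on (quotient_mult (gen_ideal (f ` {1..<i})) (f i))
        (homogeneous_part j // residue_rel (gen_ideal (f ` {1..<i}))))"

end

theory Submission
  imports Defs "HOL-Computational_Algebra.Formal_Power_Series"
begin

text \<open>Below the degree of regularity, semi-regularity and rank-nullity show that the Hilbert function of
  the quotient by \<open>(f\<^sub>1, \<dots>, f\<^sub>i)\<close> agrees with the coefficients of \<open>(1 - X\<^sup>2)\<^sup>i / (1 - X)\<^sup>n\<close>; for
  \<open>i = m\<close> these are therefore positive there. Let \<open>c\<^sub>d\<close> be the coefficients for \<open>i = m\<close> and
  \<open>N = 2m - n\<close>. The differential equation \<open>(1 - X\<^sup>2) P' = (n - N X) P\<close> gives
  \<open>k c\<^sub>k = n c\<^sub>k\<^sub>-\<^sub>1 - (N - k + 2) c\<^sub>k\<^sub>-\<^sub>2\<close>. If the earlier coefficients are nonnegative, then also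
  \<open>(k - 1) c\<^sub>k\<^sub>-\<^sub>1 \<le> n c\<^sub>k\<^sub>-\<^sub>2\<close>, so that
  \<open>k (k - 1) c\<^sub>k \<le> (n\<^sup>2 - (k - 1) (N + 2 - k)) c\<^sub>k\<^sub>-\<^sub>2 = t(k) c\<^sub>k\<^sub>-\<^sub>2\<close>. The discriminant
  is an integer, so the roots have distance at least 1 unless they both equal \<open>n + 1\<close>; hence \<open>t\<close> is
  nonpositive at the ceiling of its smaller root, and so is the coefficient with that index.\<close>

text \<open>This instance is the reversed associativity law of multiplication: as a simplification rule
  it loops with \<open>algebra_simps\<close>.\<close>

declare self_module.scale_scale [simp del]

subsection \<open>Dimensions of subspaces\<close>

context vector_space
begin

text \<open>Coordinates over \<open>A \<union> C\<close> are unique, and those of \<open>v\<close>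
  are supported in \<open>A\<close> as well as in \<open>C\<close>, hence nowhere.\<close>

lemma span_Int_disjoint_independent:
  assumes "independent (A \<union> C)" "A \<inter> C = {}" "v \<in> span A" "v \<in> span C"
  shows "v = 0"
proof -
  have "representation (A \<union> C) v = representation A v"
       "representation (A \<union> C) v = representation C v"
    using assms by (auto intro: representation_extend)
  then have "representation A v b = 0" for b
    using representation_ne_zero[of A v b] representation_ne_zero[of C v b] assms(2) by auto
  then have "(\<Sum>b | representation A v b \<noteq> 0. scale (representation A v b) b) = 0"
    by simp
  then show ?thesis
    using sum_nonzero_representation_eq[of A v] assms independent_mono[of "A \<union> C" A] by auto
qed

lemma independent_Un_disjoint_span:
  assumes "finite B" "independent A" "independent B"
    and "\<And>v. v \<in> span A \<Longrightarrow> v \<in> span B \<Longrightarrow> v = 0"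
  shows "independent (A \<union> B)"
  using assms(1,3,4)
proof (induction B rule: finite_induct)
  case (insert b B)
  have B: "independent B" "b \<notin> span B"
    using insert.prems(1) insert.hyps(2) by (auto simp: independent_insert)
  have "span B \<subseteq> span (insert b B)"
    by (intro span_mono) auto
  then have ind: "independent (A \<union> B)"
    using insert.IH B insert.prems(2) by blast
  have "b \<notin> span (A \<union> B)"
  proof
    assume "b \<in> span (A \<union> B)"
    then obtain x y where xy: "b = x + y" "x \<in> span A" "y \<in> span B"
      by (auto simp: span_Un)
    have "b - y \<in> span (insert b B)"
      using xy(3) \<open>span B \<subseteq> span (insert b B)\<close> by (intro span_diff) (auto intro: span_base)
    \<comment> \<open>\<open>x = b - y\<close> lies in both spans, so it vanishes and leaves
      \<open>b = y\<close> in \<open>span B\<close>.\<close>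
    then have "x = 0"
      using insert.prems(2) xy(1,2) by simp
    then show False using xy B by simp
  qed
  then show ?case
    using ind by (simp add: independent_insert)
qed (use assms(2) in simp)

text \<open>The finite spanning set makes the basis of \<open>W\<close> finite. This matters in the
  infinite-dimensional space of polynomials, since \<open>card\<close> of an infinite set is
  0.\<close>

lemma dim_mono_finite:
  assumes "V \<subseteq> W" "W \<subseteq> span F" "finite F"
  shows "dim V \<le> dim W"
proof -
  obtain B where B: "B \<subseteq> W" "independent B" "W \<subseteq> span B" "card B = dim W"
    using basis_exists .
  then have "finite B" using assms independent_span_bound[of F B] by auto
  then show ?thesis using dim_le_card[of V B] B assms by auto
qed

text \<open>Rank-nullity for the map that \<^term>\<open>T\<close> induces from \<^term>\<open>P\<close> to the quotient by \<^term>\<open>W\<close>.\<close>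

lemma dim_sum_image_plus_dim_preimage:
  assumes T: "Vector_Spaces.linear scale scale T"
    and sub: "subspace P" "subspace W"
    and fin: "P \<subseteq> span F" "finite F" "W \<subseteq> span F'" "finite F'"
  shows "dim {w + T p | w p. w \<in> W \<and> p \<in> P} + dim {p \<in> P. T p \<in> W} = dim W + dim P"
proof -
  interpret T: Vector_Spaces.linear scale scale T by (rule T)
  let ?A = "{p \<in> P. T p \<in> W}"
  have subA: "subspace ?A"
    using sub by (auto simp: subspace_def T.zero T.add T.scale)
  obtain B where B: "B \<subseteq> ?A" "independent B" "?A \<subseteq> span B" "card B = dim ?A"
    using basis_exists .
  obtain E where E: "B \<subseteq> E" "E \<subseteq> P" "independent E" "P \<subseteq> span E"
    using maximal_independent_subset_extend[of B P] B by blast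
  obtain D where D: "D \<subseteq> W" "independent D" "W \<subseteq> span D" "card D = dim W"
    using basis_exists .
  \<comment> \<open>\<open>?A\<close> is the kernel of the induced map, and \<open>C\<close> spans a
    complement of it in \<open>P\<close>. So \<open>T\<close> is injective on \<open>span C\<close>,
    and the images of \<open>C\<close> extend \<open>D\<close> to a basis of the sum.\<close>
  define C where "C = E - B"
  have finE: "finite E" and finD: "finite D"
    using independent_span_bound[of F E] independent_span_bound[of F' D] E D fin by auto
  have finC: "finite C" and indC: "independent C" and EBC: "E = B \<union> C" "B \<inter> C = {}"
    using finE E independent_mono[of E C] by (auto simp: C_def)
  have spanC: "span C \<subseteq> P"
    using sub(1) E by (intro span_minimal) (auto simp: C_def)
  have spanD: "span D = W"
    using D sub(2) span_minimal[of D W] by auto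
  have *: "x = 0" if "x \<in> span C" "T x \<in> W" for x
    using span_Int_disjoint_independent[of B C x] that spanC B E EBC by auto
  have inj: "inj_on T (span C)"
  proof (rule inj_onI)
    fix x y assume "x \<in> span C" "y \<in> span C" "T x = T y"
    then have "x - y = 0"
      by (intro *) (auto simp: span_diff T.diff subspace_0[OF sub(2)])
    then show "x = y" by simp
  qed
  have injC: "inj_on T C"
    using inj span_superset by (rule inj_on_subset)
  have indTC: "independent (T ` C)"
    using indC inj by (rule T.independent_injective_image)
  have zero: "v = 0" if "v \<in> span D" "v \<in> span (T ` C)" for v
    using that *[folded spanD] by (metis T.span_image T.zero imageE)
  have ind: "independent (D \<union> T ` C)"
    using finC D(2) indTC zero by (intro independent_Un_disjoint_span) auto
  have disj: "D \<inter> T ` C = {}"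
  proof -
    have "0 \<in> D" if "v \<in> D" "v \<in> T ` C" for v
      using zero[OF span_base span_base, OF that] that by simp
    then show ?thesis using D(2) dependent_zero by auto
  qed
  have "span (D \<union> T ` C) = {w + T p | w p. w \<in> W \<and> p \<in> P}" (is "_ = ?R")
  proof
    show "span (D \<union> T ` C) \<subseteq> ?R"
      using spanC by (auto simp: span_Un spanD T.span_image)
    show "?R \<subseteq> span (D \<union> T ` C)"
    proof safe
      fix w p assume wp: "w \<in> W" "p \<in> P"
      then obtain b c where bc: "p = b + c" "b \<in> span B" "c \<in> span C"
        using E(4) by (auto simp: EBC span_Un)
      \<comment> \<open>The kernel part of \<open>p\<close> is sent into \<open>W\<close>, so
        \<open>w\<close> absorbs it.\<close>
      have "b \<in> ?A" using bc(2) B(1) subA span_minimal by blast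
      then have "w + T b \<in> span D"
        using wp sub(2) by (auto simp: spanD subspace_add)
      moreover have "w + T p = (w + T b) + T c"
        by (simp add: bc T.add add.assoc)
      ultimately show "w + T p \<in> span (D \<union> T ` C)"
        using bc(3) unfolding span_Un T.span_image by blast
    qed
  qed
  then have "dim ?R = card (D \<union> T ` C)"
    using dim_span_eq_card_independent[OF ind] by simp
  also have "\<dots> = card D + card C"
    using finD finC disj injC by (simp add: card_Un_disjoint card_image)
  finally have "dim ?R = dim W + card C" using D by simp
  moreover have "dim P = card B + card C"
    using dim_unique[of E P] E finE by (simp add: EBC card_Un_disjoint)
  ultimately show ?thesis using B by simp
qed

end

subsection \<open>Homogeneous components\<close>

lemma poly_scale_conv_mult: "poly_scale c p = Poly_Mapping.single 0 c * p"
  by (simp add: poly_scale_def mult_map_scale_conv_mult)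

lemma linear_mult_right:
  fixes h :: "('n, 'k::field) mpoly"
  shows "Vector_Spaces.linear poly_scale poly_scale (\<lambda>g. g * h)"
  unfolding Vector_Spaces.linear_iff
proof (intro conjI allI)
  show "(x + y) * h = x * h + y * h" for x y
    by (rule distrib_right)
  show "poly_scale c x * h = poly_scale c (x * h)" for c x
    unfolding poly_scale_conv_mult by (rule mult.assoc)
qed (rule poly_vs.vector_space_axioms)+

lemma mono_degree_add: "mono_degree (a + b) = mono_degree a + mono_degree b"
  by (simp add: mono_degree_def lookup_add sum.distrib)

lemma subspace_homogeneous_part: "poly_vs.subspace (homogeneous_part d :: ('n::finite, 'k::field) mpoly set)"
proof (rule poly_vs.subspaceI)
  fix p q :: "('n, 'k) mpoly" and c
  assume p: "p \<in> homogeneous_part d"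
  show "poly_scale c p \<in> homogeneous_part d"
    using p by (auto simp: homogeneous_part_def in_keys_iff)
  assume q: "q \<in> homogeneous_part d"
  show "p + q \<in> homogeneous_part d"
    using p q keys_add[of p q] by (auto simp: homogeneous_part_def)
qed (simp add: homogeneous_part_def)

lemma subspace_gen_ideal: "poly_vs.subspace (gen_ideal G)"
  unfolding poly_vs.subspace_def poly_scale_conv_mult
  by (intro conjI ballI allI self_module.span_zero self_module.span_add self_module.span_scale)

lemma mult_homogeneous_part:
  fixes p q :: "('n::finite, 'k::field) mpoly"
  assumes "p \<in> homogeneous_part d" "q \<in> homogeneous_part e"
  shows "p * q \<in> homogeneous_part (d + e)"
  using assms keys_mult[of p q] by (fastforce simp: homogeneous_part_def mono_degree_add)

section \<open>Projection to a homogeneous component\<close>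

definition component :: "nat \<Rightarrow> ('n::finite, 'k::zero) mpoly \<Rightarrow> ('n, 'k) mpoly" where
  "component d p = Poly_Mapping.mapp (\<lambda>a c. c when mono_degree a = d) p"

lemma lookup_component:
  "Poly_Mapping.lookup (component d p) a = (Poly_Mapping.lookup p a when mono_degree a = d)"
  by (auto simp: component_def mapp.rep_eq when_def in_keys_iff)

lemma component_in_homogeneous_part: "component d p \<in> homogeneous_part d"
  by (auto simp: homogeneous_part_def in_keys_iff lookup_component)

lemma component_add: "component d (p + q) = component d p + component d q"
  by (rule poly_mapping_eqI) (simp add: lookup_component lookup_add when_def)

lemma component_homogeneous_part:
  "p \<in> homogeneous_part e \<Longrightarrow> component d p = (if d = e then p else 0)"
  by (rule poly_mapping_eqI)
    (auto simp: lookup_component homogeneous_part_def in_keys_iff when_def)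

lemma component_eq_0:
  assumes "\<And>a. a \<in> Poly_Mapping.keys p \<Longrightarrow> mono_degree a \<noteq> d"
  shows "component d p = 0"
  using assms by (intro poly_mapping_eqI) (auto simp: lookup_component in_keys_iff when_def)

text \<open>Multiplication by \<open>f\<close> shifts degrees by exactly \<open>e\<close>, so only
  the component of \<open>g\<close> in degree \<open>d - e\<close> contributes. The case distinction
  guards against truncated subtraction.\<close>

lemma component_mult:
  fixes f g :: "('n::finite, 'k::field) mpoly"
  assumes f: "f \<in> homogeneous_part e"
  shows "component d (g * f) = (if e \<le> d then component (d - e) g * f else 0)"
proof (cases "e \<le> d")
  case True
  let ?h = "component (d - e) g"
  let ?r = "g - ?h"
  have "component d (?r * f) = 0"
  proof (rule component_eq_0)
    fix a assume "a \<in> Poly_Mapping.keys (?r * f)"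
    then obtain b c where a: "a = b + c" "b \<in> Poly_Mapping.keys ?r" "c \<in> Poly_Mapping.keys f"
      using keys_mult[of ?r f] by blast
    then have "mono_degree b \<noteq> d - e"
      by (auto simp: in_keys_iff lookup_minus lookup_component when_def split: if_splits)
    moreover have "mono_degree c = e" using a f by (auto simp: homogeneous_part_def)
    ultimately show "mono_degree a \<noteq> d" by (auto simp: a mono_degree_add)
  qed
  moreover have "?h * f \<in> homogeneous_part d"
    using mult_homogeneous_part[OF component_in_homogeneous_part f, of "d - e" g] True by simp
  moreover have "g * f = ?h * f + ?r * f" by (simp add: algebra_simps)
  ultimately show ?thesis
    using True component_add[of d "?h * f" "?r * f"] by (simp add: component_homogeneous_part)
next
  case False
  then have "component d (g * f) = 0"
    using keys_mult[of g f] f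
    by (intro component_eq_0) (auto simp: homogeneous_part_def mono_degree_add)
  then show ?thesis using False by simp
qed

lemma component_0: "component d 0 = 0"
  by (rule component_eq_0) simp

text \<open>By \<open>component_mult\<close>, each component of \<open>c * x\<close> is again a
  multiple of the generator \<open>x\<close>.\<close>

lemma component_gen_ideal:
  fixes G :: "('n::finite, 'k::field) mpoly set"
  assumes G: "\<And>g. g \<in> G \<Longrightarrow> g \<in> homogeneous_part e" and p: "p \<in> gen_ideal G"
  shows "component d p \<in> gen_ideal G"
  using p
proof (induction rule: self_module.span_induct_alt)
  case base
  show ?case by (simp add: component_0 self_module.span_zero)
next
  case (step c x y)
  have "component d (c * x) \<in> gen_ideal G"
    using step(1) self_module.span_scale[OF self_module.span_base[OF step(1)]]
    by (simp add: component_mult[OF G[OF step(1)]] self_module.span_zero)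
  then show ?case
    using step.IH by (simp add: component_add self_module.span_add)
qed

lemma gen_ideal_homogeneous_part_trivial:
  fixes G :: "('n::finite, 'k::field) mpoly set"
  assumes G: "\<And>g. g \<in> G \<Longrightarrow> g \<in> homogeneous_part e" and "d < e"
  shows "gen_ideal G \<inter> homogeneous_part d = {0}"
proof -
  have "component d p = 0" if "p \<in> gen_ideal G" for p
    using that
  proof (induction rule: self_module.span_induct_alt)
    case (step c x y)
    then show ?case using G[of x] \<open>d < e\<close> by (simp add: component_add component_mult)
  next
    case base
    show ?case by (simp add: component_0)
  qed
  then have "p = 0" if "p \<in> gen_ideal G" "p \<in> homogeneous_part d" for p
    using that component_homogeneous_part[of p d d] by auto
  then show ?thesis
    using self_module.span_zero[of G] poly_vs.subspace_0[OF subspace_homogeneous_part] by blast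
qed

text \<open>In degree \<open>d + e\<close> only the degree \<open>d\<close> component of the
  coefficient of \<open>h\<close> matters. The right-hand side has the shape required by
  \<open>dim_sum_image_plus_dim_preimage\<close>.\<close>

lemma gen_ideal_insert_homogeneous_part:
  fixes G :: "('n::finite, 'k::field) mpoly set" and h :: "('n, 'k) mpoly"
  assumes G: "\<And>g. g \<in> G \<Longrightarrow> g \<in> homogeneous_part e" and h: "h \<in> homogeneous_part e"
  shows "gen_ideal (insert h G) \<inter> homogeneous_part (d + e) =
    {w + g * h | w g. w \<in> gen_ideal G \<inter> homogeneous_part (d + e) \<and> g \<in> homogeneous_part d}"
proof safe
  fix p assume p: "p \<in> gen_ideal (insert h G)" "p \<in> homogeneous_part (d + e)"
  then obtain g where "p - g * h \<in> gen_ideal G"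
    by (auto simp: self_module.span_insert)
  then have "component (d + e) (p - g * h) \<in> gen_ideal G"
    using G by (rule component_gen_ideal[rotated])
  moreover have "p = component (d + e) (p - g * h) + component d g * h"
    using component_add[of "d + e" "p - g * h" "g * h"] p(2)
    by (simp add: component_homogeneous_part component_mult[OF h])
  moreover have "component (d + e) (p - g * h) \<in> homogeneous_part (d + e)"
      "component d g \<in> homogeneous_part d"
    by (rule component_in_homogeneous_part)+
  ultimately show "\<exists>w g :: ('n, 'k) mpoly. p = w + g * h \<and>
      w \<in> gen_ideal G \<inter> homogeneous_part (d + e) \<and> g \<in> homogeneous_part d"
    by blast
next
  fix w g :: "('n, 'k) mpoly" assume *: "w \<in> gen_ideal G" "w \<in> homogeneous_part (d + e)" "g \<in> homogeneous_part d"
  have "w \<in> gen_ideal (insert h G)"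
    using *(1) self_module.span_mono[of G "insert h G"] by auto
  then show "w + g * h \<in> gen_ideal (insert h G)"
    by (intro self_module.span_add self_module.span_scale) (auto intro: self_module.span_base)
  show "w + g * h \<in> homogeneous_part (d + e)"
    using *(2) mult_homogeneous_part[OF *(3) h]
    by (rule poly_vs.subspace_add[OF subspace_homogeneous_part])
qed

section \<open>The monomial basis of a homogeneous part\<close>

lemma card_mono_degree:
  "finite {a :: 'n::finite \<Rightarrow>\<^sub>0 nat. mono_degree a = d}"
  "card {a :: 'n::finite \<Rightarrow>\<^sub>0 nat. mono_degree a = d} = (d + CARD('n) - 1) choose d"
proof -
  obtain xs :: "'n list" where xs: "set xs = UNIV" "distinct xs"
    using finite_distinct_list[OF finite, of "UNIV :: 'n set"] by blast
  then have len: "length xs = CARD('n)" by (metis distinct_card)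
  \<comment> \<open>Stars and bars: listing the exponents along \<open>xs\<close> identifies the
    monomials of degree \<open>d\<close> with these lists, which \<open>card_length_sum_list\<close>
    counts.\<close>
  let ?L = "{l::nat list. length l = CARD('n) \<and> sum_list l = d}"
  let ?g = "\<lambda>a :: 'n \<Rightarrow>\<^sub>0 nat. map (Poly_Mapping.lookup a) xs"
  have deg: "mono_degree a = sum_list (?g a)" for a :: "'n \<Rightarrow>\<^sub>0 nat"
    using xs by (simp add: mono_degree_def sum_list_distinct_conv_sum_set)
  have inj: "inj ?g"
    using xs by (auto intro!: injI poly_mapping_eqI)
  have img: "?g ` {a. mono_degree a = d} = ?L"
  proof (intro equalityI subsetI)
    fix l assume l: "l \<in> ?L"
    define a where "a = Abs_poly_mapping (\<lambda>x. the (map_of (zip xs l) x))"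
    have "Poly_Mapping.lookup a = (\<lambda>x. the (map_of (zip xs l) x))"
      unfolding a_def by (rule lookup_Abs_poly_mapping) simp
    then have "?g a = l"
      using l len xs(2) by (intro nth_equalityI) (auto simp: map_of_zip_nth)
    then show "l \<in> ?g ` {a. mono_degree a = d}" using l deg by force
  qed (use deg len in auto)
  have bij: "bij_betw ?g {a. mono_degree a = d} ?L"
    unfolding bij_betw_def using img inj_on_subset[OF inj subset_UNIV] by simp
  have "finite ?L"
    by (rule finite_subset[OF _ finite_lists_length_eq[of "{..d}" "CARD('n)"]])
      (auto intro: member_le_sum_list)
  then show "finite {a :: 'n \<Rightarrow>\<^sub>0 nat. mono_degree a = d}"
    using bij bij_betw_finite by blast
  show "card {a :: 'n \<Rightarrow>\<^sub>0 nat. mono_degree a = d} = (d + CARD('n) - 1) choose d"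
    using bij_betw_same_card[OF bij] card_length_sum_list by metis
qed

definition monomials :: "nat \<Rightarrow> ('n::finite, 'k::field) mpoly set" where
  "monomials d = (\<lambda>a. Poly_Mapping.single a 1) ` {a. mono_degree a = d}"

lemma finite_monomials: "finite (monomials d)"
  by (simp add: monomials_def card_mono_degree)

lemma card_monomials:
  "card (monomials d :: ('n::finite, 'k::field) mpoly set) = (d + CARD('n) - 1) choose d"
proof -
  have "inj (\<lambda>a :: 'n \<Rightarrow>\<^sub>0 nat. Poly_Mapping.single a (1 :: 'k))"
    by (rule injI) (metis keys_single singleton_inject zero_neq_one)
  then show ?thesis
    unfolding monomials_def by (subst card_image) (auto simp: card_mono_degree intro: inj_on_subset)
qed

lemma sum_lookup_single:
  assumes "finite A" "Poly_Mapping.keys p \<subseteq> A"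
  shows "(\<Sum>a\<in>A. poly_scale (Poly_Mapping.lookup p a) (Poly_Mapping.single a 1)) = p"
proof (rule poly_mapping_eqI)
  fix b
  have "b \<notin> A \<Longrightarrow> Poly_Mapping.lookup p b = 0"
    using assms(2) by (auto simp: in_keys_iff)
  then show "Poly_Mapping.lookup (\<Sum>a\<in>A. poly_scale (Poly_Mapping.lookup p a) (Poly_Mapping.single a 1)) b =
     Poly_Mapping.lookup p b"
    using assms(1) by (auto simp: lookup_sum lookup_single when_def if_distrib sum.delta cong: if_cong)
qed

lemma homogeneous_part_subset_span_monomials:
  "homogeneous_part d \<subseteq> poly_vs.span (monomials d)"
proof
  fix p :: "('n::finite, 'k::field) mpoly" assume "p \<in> homogeneous_part d"
  then have "p = (\<Sum>a | mono_degree a = d. poly_scale (Poly_Mapping.lookup p a) (Poly_Mapping.single a 1))"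
    by (intro sum_lookup_single[symmetric] card_mono_degree) (auto simp: homogeneous_part_def)
  also have "\<dots> \<in> poly_vs.span (monomials d)"
    by (intro poly_vs.span_sum poly_vs.span_scale poly_vs.span_base) (auto simp: monomials_def)
  finally show "p \<in> poly_vs.span (monomials d)" .
qed

lemma independent_monomials: "poly_vs.independent (monomials d :: ('n::finite, 'k::field) mpoly set)"
proof (rule poly_vs.independent_if_scalars_zero[OF finite_monomials])
  fix u :: "('n, 'k) mpoly \<Rightarrow> 'k" and x :: "('n, 'k) mpoly"
  assume 0: "(\<Sum>x\<in>monomials d. poly_scale (u x) x) = 0" and x: "x \<in> monomials d"
  from x obtain a where a: "x = Poly_Mapping.single a 1" "mono_degree a = d"
    by (auto simp: monomials_def)
  have "Poly_Mapping.lookup y a = (if y = x then 1 else 0)" if "y \<in> monomials d" for y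
    using that by (auto simp: a monomials_def lookup_single when_def)
  then have "(\<Sum>y\<in>monomials d. u y * Poly_Mapping.lookup y a) = (\<Sum>y\<in>monomials d. if y = x then u x else 0)"
    by (intro sum.cong) auto
  also have "\<dots> = u x"
    using x by (simp add: sum.delta finite_monomials)
  finally show "u x = 0"
    using arg_cong[OF 0, of "\<lambda>p. Poly_Mapping.lookup p a"] by (simp add: lookup_sum)
qed

lemma dim_homogeneous_part:
  "poly_vs.dim (homogeneous_part d :: ('n::finite, 'k::field) mpoly set) = (d + CARD('n) - 1) choose d"
proof (rule poly_vs.dim_unique)
  show "monomials d \<subseteq> (homogeneous_part d :: ('n, 'k) mpoly set)"
    by (auto simp: monomials_def homogeneous_part_def)
qed (simp_all add: homogeneous_part_subset_span_monomials independent_monomials card_monomials)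

subsection \<open>The generating series\<close>

text \<open>For a regular sequence of \<open>m\<close> quadrics this would be the Hilbert function
  of the quotient. Once \<open>m > n\<close>, negative values occur.\<close>

definition hilbert_coeff :: "nat \<Rightarrow> nat \<Rightarrow> nat \<Rightarrow> real" where
  "hilbert_coeff n m d = fps_nth ((1 - fps_X\<^sup>2) ^ m * inverse ((1 - fps_X) ^ n)) d"

lemma hilbert_coeff_0:
  assumes "n > 0"
  shows "hilbert_coeff n 0 d = real ((d + n - 1) choose d)"
  using one_minus_const_fps_X_neg_power'[OF assms, of "1::real"]
  by (simp add: hilbert_coeff_def add.commute)

text \<open>Numerical counterpart of adding one quadric \<open>h\<close>: the subtracted term
  accounts for the multiples \<open>g * h\<close> with \<open>g\<close> of degree
  \<open>d - 2\<close>.\<close>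

lemma hilbert_coeff_Suc:
  "hilbert_coeff n (Suc m) d =
    hilbert_coeff n m d - (if d < 2 then 0 else hilbert_coeff n m (d - 2))"
proof -
  let ?P = "(1 - fps_X\<^sup>2) ^ m * inverse ((1 - fps_X) ^ n) :: real fps"
  have "(1 - fps_X\<^sup>2) ^ Suc m * inverse ((1 - fps_X) ^ n) = ?P - fps_X\<^sup>2 * ?P"
    by (simp add: algebra_simps)
  then show ?thesis
    by (simp add: hilbert_coeff_def fps_X_power_mult_nth)
qed

text \<open>Comparison of coefficients in the differential equation of the series. The factor
  \<open>1 - X\<^sup>2 = (1 - X) (1 + X)\<close> clears the denominators of the logarithmic
  derivatives of both factors.\<close>

lemma hilbert_coeff_rec:
  shows "hilbert_coeff n m 1 = real n * hilbert_coeff n m 0"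
    and "real (d + 2) * hilbert_coeff n m (d + 2) =
      real n * hilbert_coeff n m (d + 1) - (2 * real m - real n - real d) * hilbert_coeff n m d"
proof -
  let ?X = "fps_X :: real fps"
  define G where "G = inverse (1 - ?X)"
  define P where "P = (1 - ?X\<^sup>2) ^ m * G ^ n"
  have P: "hilbert_coeff n m d = fps_nth P d" for d
    by (simp add: hilbert_coeff_def P_def G_def fps_inverse_power)
  have G: "(1 - ?X) * G = 1"
    unfolding G_def by (rule inverse_mult_eq_1') simp
  have "(1 - ?X) * fps_deriv G = G"
    using arg_cong[OF G, of fps_deriv] by (simp add: algebra_simps)
  moreover have "(1 - ?X) * fps_deriv (G ^ n) = of_nat n * ((1 - ?X) * fps_deriv G) * G ^ (n - 1)"
    by (simp only: fps_deriv_power' mult_ac)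
  ultimately have dG: "(1 - ?X) * fps_deriv (G ^ n) = of_nat n * G ^ n"
    by (cases n) (simp_all add: mult.assoc)
  have dM: "(1 - ?X\<^sup>2) * fps_deriv ((1 - ?X\<^sup>2) ^ m) = - (of_nat (2 * m) * ?X) * (1 - ?X\<^sup>2) ^ m"
  proof -
    have "(1 - ?X\<^sup>2) * fps_deriv ((1 - ?X\<^sup>2) ^ m) =
        of_nat m * fps_deriv (1 - ?X\<^sup>2) * ((1 - ?X\<^sup>2) * (1 - ?X\<^sup>2) ^ (m - 1))"
      by (simp only: fps_deriv_power' mult_ac)
    then show ?thesis
      by (cases m) (simp_all add: fps_deriv_power' mult.assoc)
  qed
  have const: "of_nat n = fps_const (real n)"
      "of_nat (2 * m) - of_nat n = fps_const (2 * real m - real n)"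
    by (simp_all only: fps_of_nat[symmetric] fps_const_sub) simp
  have "(1 - ?X\<^sup>2) * fps_deriv P =
      ((1 - ?X\<^sup>2) * fps_deriv ((1 - ?X\<^sup>2) ^ m)) * G ^ n +
      (1 + ?X) * (1 - ?X\<^sup>2) ^ m * ((1 - ?X) * fps_deriv (G ^ n))"
    by (simp add: P_def algebra_simps power2_eq_square)
  also have "\<dots> = of_nat n * P - (of_nat (2 * m) - of_nat n) * (?X * P)"
    unfolding dG dM by (simp add: P_def algebra_simps)
  also have "\<dots> = fps_const (real n) * P - fps_const (2 * real m - real n) * (?X * P)"
    by (simp only: const(2)) (simp only: const(1))
  finally have *: "fps_deriv P - ?X\<^sup>2 * fps_deriv P =
      fps_const (real n) * P - fps_const (2 * real m - real n) * (?X * P)"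
    by (simp add: algebra_simps)
  show "hilbert_coeff n m 1 = real n * hilbert_coeff n m 0"
    using arg_cong[OF *, of "\<lambda>F. fps_nth F 0"] by (simp add: P)
  \<comment> \<open>At \<open>d = 0\<close> both sides vanish, as a multiple of
    \<open>?X\<^sup>2\<close> has no linear term.\<close>
  have "fps_nth (?X\<^sup>2 * fps_deriv P) (Suc d) = real d * fps_nth P d"
    by (cases d) (auto simp: fps_X_power_mult_nth)
  then show "real (d + 2) * hilbert_coeff n m (d + 2) =
      real n * hilbert_coeff n m (d + 1) - (2 * real m - real n - real d) * hilbert_coeff n m d"
    using arg_cong[OF *, of "\<lambda>F. fps_nth F (Suc d)"] by (simp add: P algebra_simps)
qed

text \<open>The second assumption is \<open>t(d + 2) \<le> 0\<close>, because
  \<open>t(k) = n\<^sup>2 - (k - 1) (2m - n + 2 - k)\<close>.\<close>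

lemma hilbert_coeff_nonpos:
  assumes pos: "\<And>j. j \<le> d \<Longrightarrow> hilbert_coeff n m j \<ge> 0"
    and d: "(real n)\<^sup>2 \<le> real (d + 1) * (2 * real m - real n - real d)"
  shows "hilbert_coeff n m (d + 2) \<le> 0"
proof -
  let ?c = "hilbert_coeff n m" and ?N = "2 * real m - real n"
  have "0 \<le> real (d + 1) * (?N - real d)"
    using d zero_le_power2 order_trans by blast
  then have N: "?N \<ge> real d"
    by (simp add: zero_le_mult_iff)
  \<comment> \<open>The recurrence one index lower, with its subtracted term dropped; that term is
    nonnegative by \<open>N\<close>.\<close>
  have le: "real (d + 1) * ?c (d + 1) \<le> real n * ?c d"
  proof (cases d)
    case 0
    then show ?thesis using hilbert_coeff_rec(1)[of n m] by simp
  next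
    case (Suc e)
    have "0 \<le> (?N - real e) * ?c e"
      using N pos[of e] Suc by (intro mult_nonneg_nonneg) auto
    then show ?thesis using hilbert_coeff_rec(2)[of e n m] Suc by simp
  qed
  have "real (d + 1) * (real (d + 2) * ?c (d + 2)) =
      real n * (real (d + 1) * ?c (d + 1)) - real (d + 1) * (?N - real d) * ?c d"
    unfolding hilbert_coeff_rec(2) by (simp add: algebra_simps)
  also have "\<dots> \<le> real n * (real n * ?c d) - real (d + 1) * (?N - real d) * ?c d"
    using le by (intro diff_right_mono mult_left_mono) auto
  also have "\<dots> = ((real n)\<^sup>2 - real (d + 1) * (?N - real d)) * ?c d"
    by (simp add: algebra_simps power2_eq_square)
  also have "\<dots> \<le> 0"
    using d pos[of d] by (intro mult_nonpos_nonneg) auto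
  finally show ?thesis
    by (simp add: mult_le_0_iff)
qed

section \<open>The ceiling of the smaller root\<close>

lemma ceiling_root_bounds:
  fixes m n :: nat
  defines "D \<equiv> (2 * real m - real n + 1)\<^sup>2 - 4 * (real n)\<^sup>2"
  defines "k0 \<equiv> (2 * real m - real n + 3 - sqrt D) / 2"
  assumes mn: "m > n" "n \<ge> 1" and D: "D \<ge> 0"
  obtains d where "int (d + 2) = \<lceil>k0\<rceil>"
    "(real n)\<^sup>2 \<le> real (d + 1) * (2 * real m - real n - real d)"
proof -
  let ?N = "2 * real m - real n" and ?K = "of_int \<lceil>k0\<rceil> :: real"
  have N: "?N + 1 > 0" using mn by simp
  have sq: "(sqrt D)\<^sup>2 = D" using D by simp
  \<comment> \<open>As \<open>n \<ge> 1\<close>, this forces \<open>k0 > 1\<close>, so the ceiling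
    is at least 2 and has the form \<open>d + 2\<close>.\<close>
  have "D < (?N + 1)\<^sup>2" using mn by (simp add: D_def)
  then have "sqrt D < ?N + 1"
    using N by (intro real_less_lsqrt) auto
  then have "k0 > 1" by (simp add: k0_def)
  then have "\<lceil>k0\<rceil> \<ge> 2" by linarith
  then obtain e where "\<lceil>k0\<rceil> = 2 + int e"
    using zle_iff_zadd by blast
  then have d: "int (e + 2) = \<lceil>k0\<rceil>" by simp
  then have K: "?K = real e + 2" by (simp flip: d)
  \<comment> \<open>\<open>k0 + sqrt D\<close> is the larger root, so this puts the ceiling between
    the two roots.\<close>
  have "?K \<le> k0 + sqrt D"
  proof (cases "D = 0")
    case True
    then have "(?N + 1)\<^sup>2 = (2 * real n)\<^sup>2" by (simp add: D_def power_mult_distrib)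
    then have "?N + 1 = 2 * real n" by (rule power2_eq_imp_eq) (use N in auto)
    then have k0: "k0 = of_int (int n + 1)" using True by (simp add: k0_def)
    have "\<lceil>k0\<rceil> = int n + 1" unfolding k0 by (rule ceiling_of_int)
    then show ?thesis using True k0 by simp
  next
    case False
    \<comment> \<open>\<open>Z\<close> is \<open>D\<close> computed in the integers; hence a
      positive \<open>D\<close> is at least 1.\<close>
    define Z where "Z = (2 * int m - int n + 1)\<^sup>2 - 4 * (int n)\<^sup>2"
    have Z: "D = of_int Z" by (simp add: D_def Z_def)
    then have "Z \<ge> 1" using False D by simp
    then have "sqrt D \<ge> 1" using Z by simp
    then show ?thesis by linarith
  qed
  then have "(?K - k0) * (?K - (k0 + sqrt D)) \<le> 0"
    by (intro mult_nonneg_nonpos) simp_all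
  \<comment> \<open>Four times \<open>t(x)\<close>: factored into its roots on the left, with the
    square completed on the right.\<close>
  moreover have "4 * ((x - k0) * (x - (k0 + sqrt D))) = (2 * x - ?N - 3)\<^sup>2 - (sqrt D)\<^sup>2" for x
  proof -
    have "?N = 2 * k0 + sqrt D - 3" by (simp add: k0_def field_simps)
    then show ?thesis by (simp only:) (simp add: power2_eq_square algebra_simps)
  qed
  ultimately have "(2 * ?K - ?N - 3)\<^sup>2 - D \<le> 0"
    unfolding sq by (metis mult_le_0_iff not_numeral_le_zero zero_le_numeral)
  also have "(2 * ?K - ?N - 3)\<^sup>2 - D = 4 * ((real n)\<^sup>2 - real (e + 1) * (?N - real e))"
    unfolding K D_def by (simp add: power2_eq_square algebra_simps)
  finally have "(real n)\<^sup>2 \<le> real (e + 1) * (?N - real e)"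
    by simp
  with d show thesis by (rule that)
qed

lemma quadratic_discrim:
  fixes m n :: real
  defines "D \<equiv> (2 * m - n + 1)\<^sup>2 - 4 * n\<^sup>2"
  shows "discrim 1 (- (2 * m - n + 3)) (2 * m - n + 2 + n\<^sup>2) = D"
  by (simp add: discrim_def D_def power2_eq_square algebra_simps)

subsection \<open>Semi-regular sequences\<close>

text \<open>Injectivity is applied to the classes of \<open>g\<close> and 0, which have the same
  image. Both lie in the domain because 0 is homogeneous of degree \<open>j\<close>.\<close>

lemma semi_regular_cancel:
  fixes f :: "nat \<Rightarrow> ('n::finite, 'k::field) mpoly"
  assumes sr: "semi_regular m f" and i: "i \<in> {1..m}"
    and j: "j + 2 < degree_of_regularity (gen_ideal (f ` {1..m}))"
    and g: "g \<in> homogeneous_part j" and gf: "g * f i \<in> gen_ideal (f ` {1..<i})"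
  shows "g \<in> gen_ideal (f ` {1..<i})"
proof -
  let ?I = "gen_ideal (f ` {1..<i})"
  let ?r = "residue_rel ?I"
  have eq: "?r `` {p} = ?r `` {0} \<longleftrightarrow> p \<in> ?I" for p
    using eq_equiv_class_iff[OF equiv_residue_rel, of 0 p "f ` {1..<i}"]
    by (auto simp: residue_rel_def)
  have 0: "(0 :: ('n, 'k) mpoly) \<in> homogeneous_part j"
    by (rule poly_vs.subspace_0[OF subspace_homogeneous_part])
  have "quotient_mult ?I (f i) (?r `` {g}) = ?r `` {g * f i}"
    by (rule quotient_mult_class)
  also have "\<dots> = ?r `` {0}"
    using eq gf by blast
  also have "\<dots> = quotient_mult ?I (f i) (?r `` {0})"
    using quotient_mult_class[of "f ` {1..<i}" "f i" 0] by simp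
  finally have "quotient_mult ?I (f i) (?r `` {g}) = quotient_mult ?I (f i) (?r `` {0})" .
  moreover have "inj_on (quotient_mult ?I (f i)) (homogeneous_part j // ?r)"
    using sr i j unfolding semi_regular_def by blast
  ultimately have "?r `` {g} = ?r `` {0}"
    using quotientI[OF g] quotientI[OF 0] by (blast dest: inj_onD)
  then show ?thesis
    using eq by blast
qed

text \<open>With \<open>S(i)\<close> the quotient by the first \<open>i\<close> polynomials, the
  induction step counts dimensions in the exact sequence
  \<open>0 -> S(i)_e -> S(i)_(e+2) -> S(i+1)_(e+2) -> 0\<close>, whose first map is multiplication
  by \<open>f (Suc i)\<close>. Differences of dimensions replace dimensions of quotients.\<close>

lemma hilbert_function_semi_regular:
  fixes f :: "nat \<Rightarrow> ('n::finite, 'k::field) mpoly"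
  assumes f: "\<And>i. i \<in> {1..m} \<Longrightarrow> f i \<in> homogeneous_part 2"
    and sr: "semi_regular m f" and "i \<le> m"
    and d: "d < degree_of_regularity (gen_ideal (f ` {1..m}))"
  shows "real (poly_vs.dim (homogeneous_part d :: ('n, 'k) mpoly set)) -
      real (poly_vs.dim (gen_ideal (f ` {1..i}) \<inter> homogeneous_part d)) =
    hilbert_coeff CARD('n) i d"
  using \<open>i \<le> m\<close> d
proof (induction i arbitrary: d)
  case 0
  have "gen_ideal (f ` {1..0}) \<inter> homogeneous_part d = {0}"
    using poly_vs.subspace_0[OF subspace_homogeneous_part, of d] by auto
  moreover have "poly_vs.dim {0 :: ('n, 'k) mpoly} = 0"
    by (rule poly_vs.dim_unique[of "{}"]) (auto simp: poly_vs.independent_empty)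
  ultimately show ?case
    by (simp add: dim_homogeneous_part hilbert_coeff_0)
next
  case (Suc i)
  let ?P = "homogeneous_part :: nat \<Rightarrow> ('n, 'k) mpoly set"
  let ?J = "\<lambda>i. gen_ideal (f ` {1..i})"
  have f2: "g \<in> ?P 2" if "g \<in> f ` {1..i'}" "i' \<le> m" for g i'
    using that f by auto
  show ?case
  proof (cases "d < 2")
    case True
    \<comment> \<open>Below degree 2 another quadric changes nothing, and
      \<open>hilbert_coeff_Suc\<close> subtracts nothing.\<close>
    have "?J (Suc i) \<inter> ?P d = {0}" "?J i \<inter> ?P d = {0}"
      using Suc.prems by (auto intro!: gen_ideal_homogeneous_part_trivial[OF f2 True])
    then show ?thesis
      using Suc.IH[of d] Suc.prems True by (simp add: hilbert_coeff_Suc)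
  next
    case False
    then obtain e where e: "d = e + 2"
      by (metis add.commute le_Suc_ex not_less)
    let ?h = "f (Suc i)"
    have ins: "f ` {1..Suc i} = insert ?h (f ` {1..i})"
      by (simp add: atLeastAtMostSuc_conv)
    have h: "?h \<in> ?P 2" using f Suc.prems by simp
    have J: "?J (Suc i) \<inter> ?P d =
        {w + g * ?h | w g. w \<in> ?J i \<inter> ?P d \<and> g \<in> ?P e}"
      unfolding ins e by (rule gen_ideal_insert_homogeneous_part[OF f2 h]) (use Suc.prems in auto)
    \<comment> \<open>Semi-regularity applies because \<open>e + 2 = d\<close> is below the degree
      of regularity. It reduces the kernel in rank-nullity to the ideal in degree
      \<open>e\<close>.\<close>
    have "p \<in> ?J i" if "p \<in> ?P e" "p * ?h \<in> ?J i" for p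
      using semi_regular_cancel[OF sr, of "Suc i" e p] Suc.prems that
      by (simp add: e atLeastLessThanSuc_atLeastAtMost)
    moreover have "p * ?h \<in> ?J i" if "p \<in> ?J i" for p
      using self_module.span_scale[OF that, of ?h] by (simp add: mult.commute)
    ultimately have pre: "{p \<in> ?P e. p * ?h \<in> ?J i \<inter> ?P d} = ?J i \<inter> ?P e"
      using mult_homogeneous_part[OF _ h] by (auto simp: e)
    have "poly_vs.dim (?J (Suc i) \<inter> ?P d) + poly_vs.dim (?J i \<inter> ?P e) =
        poly_vs.dim (?J i \<inter> ?P d) + poly_vs.dim (?P e)"
      unfolding J pre[symmetric]
      by (rule poly_vs.dim_sum_image_plus_dim_preimage[OF linear_mult_right
            subspace_homogeneous_part
            poly_vs.subspace_inter[OF subspace_gen_ideal subspace_homogeneous_part]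
            homogeneous_part_subset_span_monomials finite_monomials
            order_trans[OF Int_lower2 homogeneous_part_subset_span_monomials] finite_monomials])
    then show ?thesis
      using Suc.IH[of d] Suc.IH[of e] Suc.prems by (simp add: hilbert_coeff_Suc e)
  qed
qed

text \<open>The coefficient is a difference of dimensions: nonnegative by inclusion, and nonzero
  since \<open>d\<close> is below the least degree where they agree.\<close>

lemma hilbert_coeff_pos:
  fixes f :: "nat \<Rightarrow> ('n::finite, 'k::field) mpoly"
  assumes f: "\<And>i. i \<in> {1..m} \<Longrightarrow> f i \<in> homogeneous_part 2"
    and sr: "semi_regular m f"
    and d: "d < degree_of_regularity (gen_ideal (f ` {1..m}))"
  shows "hilbert_coeff CARD('n) m d > 0"
proof -
  let ?J = "gen_ideal (f ` {1..m}) \<inter> homogeneous_part d"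
  have "poly_vs.dim ?J \<le> poly_vs.dim (homogeneous_part d :: ('n, 'k) mpoly set)"
    by (rule poly_vs.dim_mono_finite[OF Int_lower2 homogeneous_part_subset_span_monomials
          finite_monomials])
  moreover have "poly_vs.dim ?J \<noteq> poly_vs.dim (homogeneous_part d :: ('n, 'k) mpoly set)"
    using d unfolding degree_of_regularity_def by (rule not_less_Least)
  ultimately show ?thesis
    using hilbert_function_semi_regular[OF f sr order_refl d] by simp
qed

theorem theorem6p1:
  fixes f :: "nat \<Rightarrow> ('n::finite, 'k::field) mpoly" and m n :: nat
  assumes "n = CARD('n)"
    and "m > n" and "n \<ge> 1"
    and "\<And>i. i \<in> {1..m} \<Longrightarrow> f i \<in> homogeneous_part 2"
    and "finite_dim_quotient (gen_ideal (f ` {1..m}))"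
    and "semi_regular m f"
    and "(2 * real m - real n + 1)\<^sup>2 - 4 * (real n)\<^sup>2 \<ge> 0"
  shows "let t = (\<lambda>k::real. k\<^sup>2 - (2 * real m - real n + 3) * k + (2 * real m - real n + 2 + (real n)\<^sup>2));
             D = (2 * real m - real n + 1)\<^sup>2 - 4 * (real n)\<^sup>2;
             k\<^sub>0 = (2 * real m - real n + 3 - sqrt D) / 2
         in discrim 1 (- (2 * real m - real n + 3)) (2 * real m - real n + 2 + (real n)\<^sup>2) = D \<and>
            t k\<^sub>0 = 0 \<and> (\<forall>k. t k = 0 \<longrightarrow> k\<^sub>0 \<le> k) \<and>
            int (degree_of_regularity (gen_ideal (f ` {1..m}))) \<le> 1 + \<lceil>k\<^sub>0\<rceil>"
proof -
  define b where "b = 2 * real m - real n + 3"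
  define c where "c = 2 * real m - real n + 2 + (real n)\<^sup>2"
  define D where "D = (2 * real m - real n + 1)\<^sup>2 - 4 * (real n)\<^sup>2"
  define k0 where "k0 = (b - sqrt D) / 2"
  have disc: "discrim 1 (- b) c = D"
    unfolding b_def c_def D_def by (rule quadratic_discrim)
  have D: "D \<ge> 0"
    using assms(7) by (simp add: D_def)
  have roots: "k\<^sup>2 - b * k + c = 0 \<longleftrightarrow> k = (b + sqrt D) / 2 \<or> k = k0" for k
    using discriminant_nonneg[of 1 "- b" c k] D by (simp add: disc k0_def)
  have least: "k0 \<le> k" if "k\<^sup>2 - b * k + c = 0" for k
    using that D unfolding roots by (auto simp: k0_def field_simps)
  obtain d where d: "int (d + 2) = \<lceil>k0\<rceil>"
      "(real n)\<^sup>2 \<le> real (d + 1) * (2 * real m - real n - real d)"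
    using ceiling_root_bounds[OF assms(2,3) assms(7)] by (auto simp: k0_def b_def D_def)
  have "degree_of_regularity (gen_ideal (f ` {1..m})) \<le> d + 2"
  \<comment> \<open>Otherwise all degrees up to \<open>d + 2\<close> lie below the degree of
    regularity, and the coefficient at \<open>d + 2\<close> would be both positive and
    nonpositive.\<close>
  proof (rule ccontr)
    assume "\<not> ?thesis"
    then have pos: "hilbert_coeff n m j > 0" if "j \<le> d + 2" for j
      unfolding assms(1) using that by (intro hilbert_coeff_pos[OF assms(4,6)]) auto
    then have "hilbert_coeff n m (d + 2) \<le> 0"
      by (intro hilbert_coeff_nonpos d(2)) (simp add: less_imp_le)
    then show False using pos[of "d + 2"] by simp
  qed
  then have "int (degree_of_regularity (gen_ideal (f ` {1..m}))) \<le> 1 + \<lceil>k0\<rceil>"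
    unfolding d(1)[symmetric] by simp
  then show ?thesis
    using disc roots[of k0] least
    unfolding Let_def D_def[symmetric] b_def[symmetric] c_def[symmetric] k0_def[symmetric] by simp
qed

end
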